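(* Let $\mathcal{P}:\mathscr{M}\to\mathbb{R}$ and $\mathcal{G}:\mathscr{M}\to\mathbb{R}^m$, let $\mathcal{S}=\{\eta\in\mathscr{M} : \mathcal{G}(\eta)\le 0\}$, and let $\eta^{*}\in\mathcal{S}$ satisfy $\mathcal{P}(\eta^{*})=\min_{\eta\in\mathcal{S}}\mathcal{P}(\eta)$. Assume that $d\mathcal{P}(\eta^{*};\eta-\eta^{*})$ and $d\mathcal{G}(\eta^{*};\eta-\eta^{*})$ exist for every $\eta\in\mathscr{M}$, and that for all $\eta_1,\eta_2\in\mathscr{M}$ and $0\le t\le 1$, $$d\mathcal{P}(\eta^{*};(1-t)\eta_1+t\eta_2-\eta^{*})=(1-t)\,d\mathcal{P}(\eta^{*};\eta_1-\eta^{*})+t\,d\mathcal{P}(\eta^{*};\eta_2-\eta^{*}),$$ and similarly for $d\mathcal{G}$. Let $r^{*}\in\mathbb{R}_+$ and $\lambda^{*}\in\mathbb{R}^m_+$ be such that $\lambda^{*}\cdot\mathcal{G}(\eta^{*})=0$ and $$r^{*}\,d\mathcal{P}(\eta^{*};\eta-\eta^{*})+\lambda^{*}\cdot d\mathcal{G}(\eta^{*};\eta-\eta^{*})\ge 0\qquad\text{for every }\eta\in\mathscr{M}.$$ Assume that there exist continuous functions $p_{\eta^{*}}:\mathbb{R}^n_+\times\mathbb{R}^n_+\to\mathbb{R}$ and $g_{\eta^{*}}:\mathbb{R}^n_+\times\mathbb{R}^n_+\to\mathbb{R}^m$, integrable with respect to all elements of $\mathscr{M}-\eta^{*}$, such that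 $$d\mathcal{P}(\eta^{*};\eta)=\int_{\mathbb{R}^n_+\times\mathbb{R}^n_+}p_{\eta^{*}}(x,y)\,\eta(dx,dy),\qquad d\mathcal{G}(\eta^{*};\eta)=\int_{\mathbb{R}^n_+\times\mathbb{R}^n_+}g_{\eta^{*}}(x,y)\,\eta(dx,dy)$$ for every $\eta\in\mathscr{M}-\eta^{*}$. Assume moreover that the partial minimization function $$m(x)=\inf_{y\in[0,x]}\big(r^{*}p_{\eta^{*}}(x,y)+\lambda^{*}\cdot g_{\eta^{*}}(x,y)\big),\qquad x\in\mathbb{R}^n_+,$$ is measurable. Then $$\eta^{*}\Big(\big\{(x,y)\in\mathcal{A}_R : y\in\operatorname{argmin}_{t\in[0,x]}\big(r^{*}p_{\eta^{*}}(x,t)+\lambda^{*}\cdot g_{\eta^{*}}(x,t)\big)\big\}\Big)=1.$$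
   Context: Fix $n,m\ge 1$ and let $\mu$ be a probability measure on $\mathbb{R}^n_+=[0,\infty)^n$, absolutely continuous with respect to Lebesgue measure, each of whose one-dimensional marginals has finite first moment. Let $\mathcal{A}_R=\{(x,y)\in\mathbb{R}^n\times\mathbb{R}^n : 0\le y_i\le x_i,\ i=1,\dots,n\}$. A (random) reinsurance treaty is a Borel probability measure $\eta$ on $\mathbb{R}^n_+\times\mathbb{R}^n_+$ whose first marginal is $\mu$ and which satisfies $\eta(\mathcal{A}_R)=1$; $\mathscr{M}$ is the (convex) set of all reinsurance treaties, with the weak topology. Standing assumptions: $\mathcal{P}$ and $\mathcal{G}$ are lower semi-continuous (the latter componentwise), and $\mathcal{S}$ is closed. Inequalities between vectors are understood componentwise; $\mathbb{R}_+=[0,\infty)$, $\mathbb{R}^m_+=[0,\infty)^m$. For $x\in\mathbb{R}^n_+$, $[0,x]=[0,x_1]\times\cdots\times[0,x_n]$. $\mathscr{M}-\eta^{*}=\{\eta-\eta^{*}:\eta\in\mathscr{M}\}$ (a set of finite signed measures). The (one-sided) directional derivative of $f$ at $u$ in direction $h$ is $df(u;h)=\lim_{t\to 0^+}\frac{f(u+th)-f(u)}{t}$, whenever the terms are defined and the limit exists; it is applied to $\mathcal{P},\mathcal{G}$ on the convex set $\mathscr{M}$ inside the vector space of finite signed measures. *)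

theory Defs
  imports "HOL-Probability.Probability"
begin

section \<open>Finite signed Borel measures\<close>

text \<open>A finite signed measure is a countably additive real function on the Borel sets. It is
  extended by 0 to the other sets, so that the vector space operations are the pointwise ones.\<close>

typedef (overloaded) 'a signed_measure =
  "{\<nu> :: 'a::topological_space set \<Rightarrow> real.
     (\<forall>A. A \<notin> sets borel \<longrightarrow> \<nu> A = 0) \<and>
     (\<forall>A :: nat \<Rightarrow> 'a set. range A \<subseteq> sets borel \<longrightarrow> disjoint_family A \<longrightarrow>
        (\<lambda>i. \<nu> (A i)) sums \<nu> (\<Union>i. A i))}"
  morphisms sm_value Abs_signed_measure
  by (rule exI [of _ "\<lambda>_. 0"]) simp

setup_lifting type_definition_signed_measure

instantiation signed_measure :: (topological_space) real_vector
begin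

lift_definition zero_signed_measure :: "'a signed_measure" is "\<lambda>_. 0"
  by simp

lift_definition plus_signed_measure ::
    "'a signed_measure \<Rightarrow> 'a signed_measure \<Rightarrow> 'a signed_measure" is "\<lambda>\<mu> \<nu> A. \<mu> A + \<nu> A"
  by (auto intro!: sums_add)

lift_definition minus_signed_measure ::
    "'a signed_measure \<Rightarrow> 'a signed_measure \<Rightarrow> 'a signed_measure" is "\<lambda>\<mu> \<nu> A. \<mu> A - \<nu> A"
  by (auto intro!: sums_diff)

lift_definition uminus_signed_measure :: "'a signed_measure \<Rightarrow> 'a signed_measure"
  is "\<lambda>\<nu> A. - \<nu> A"
  by (auto intro!: sums_minus)

lift_definition scaleR_signed_measure :: "real \<Rightarrow> 'a signed_measure \<Rightarrow> 'a signed_measure"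
  is "\<lambda>c \<nu> A. c * \<nu> A"
  by (auto intro!: sums_mult)

instance
  by standard (transfer; auto simp: algebra_simps)+

end

lift_definition sm_of_measure :: "'a::topological_space measure \<Rightarrow> 'a signed_measure"
  is "\<lambda>M A. if sets M = sets borel \<and> finite_measure M then measure M A else 0"
proof (intro conjI allI impI)
  fix M :: "'a measure" and A :: "'a set"
  assume "A \<notin> sets borel"
  then show "(if sets M = sets borel \<and> finite_measure M then measure M A else 0) = 0"
    by (auto intro: measure_notin_sets)
next
  fix M :: "'a measure" and A :: "nat \<Rightarrow> 'a set"
  assume A: "range A \<subseteq> sets borel" "disjoint_family A"
  show "(\<lambda>i. if sets M = sets borel \<and> finite_measure M then measure M (A i) else 0) sums
        (if sets M = sets borel \<and> finite_measure M then measure M (\<Union>i. A i) else 0)"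
  proof (cases "sets M = sets borel \<and> finite_measure M")
    case True
    with A show ?thesis
      by (auto intro!: finite_measure.finite_measure_UNION)
  next
    case False
    then show ?thesis
      by (simp only: if_False sums_zero)
  qed
qed

text \<open>Jordan decomposition: \<open>\<nu>\<^sup>+(A)\<close> is the supremum of \<open>\<nu>(B)\<close> over the measurable
  \<open>B \<subseteq> A\<close>, and \<open>\<nu>\<^sup>- = (-\<nu>)\<^sup>+\<close>.\<close>

definition sm_pos :: "'a::topological_space signed_measure \<Rightarrow> 'a measure" where
  "sm_pos \<nu> = measure_of UNIV (sets borel)
     (\<lambda>A. SUP B \<in> {B \<in> sets borel. B \<subseteq> A}. ennreal (sm_value \<nu> B))"

definition sm_neg :: "'a::topological_space signed_measure \<Rightarrow> 'a measure" where
  "sm_neg \<nu> = sm_pos (- \<nu>)"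

definition sm_integrable_on ::
    "'a::topological_space signed_measure \<Rightarrow> 'a set \<Rightarrow> ('a \<Rightarrow> 'b::{banach, second_countable_topology}) \<Rightarrow> bool"
  where
  "sm_integrable_on \<nu> D f \<longleftrightarrow> set_integrable (sm_pos \<nu>) D f \<and> set_integrable (sm_neg \<nu>) D f"

definition sm_integral ::
    "'a::topological_space signed_measure \<Rightarrow> 'a set \<Rightarrow> ('a \<Rightarrow> 'b::{banach, second_countable_topology}) \<Rightarrow> 'b"
  where
  "sm_integral \<nu> D f =
     set_lebesgue_integral (sm_pos \<nu>) D f - set_lebesgue_integral (sm_neg \<nu>) D f"

text \<open>The topology generated by integration of the bounded continuous functions on the
  state space \<open>D\<close>.\<close>

definition weak_topology :: "'a::topological_space set \<Rightarrow> 'a signed_measure topology" where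
  "weak_topology D = topology_generated_by
     {{\<nu>. sm_integral \<nu> D f \<in> U} | (f :: 'a \<Rightarrow> real) U.
        continuous_on D f \<and> bounded (f ` D) \<and> open U}"

subsection \<open>The Jordan decomposition consists of measures\<close>

lemma sm_value_notin [simp]: "A \<notin> sets borel \<Longrightarrow> sm_value \<nu> A = 0"
  by transfer simp

lemma sm_value_sums:
  "range A \<subseteq> sets borel \<Longrightarrow> disjoint_family A \<Longrightarrow>
     (\<lambda>i. sm_value \<nu> (A i)) sums sm_value \<nu> (\<Union>i. A i)"
  for A :: "nat \<Rightarrow> 'a::topological_space set"
  by transfer auto

lemma sm_value_empty [simp]: "sm_value \<nu> {} = 0"
proof -
  have "(\<lambda>i::nat. sm_value \<nu> {}) sums sm_value \<nu> (\<Union>i::nat. {})"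
    by (rule sm_value_sums) (auto simp: disjoint_family_on_def)
  then have "summable (\<lambda>i::nat. sm_value \<nu> {})"
    by (rule sums_summable)
  then show ?thesis
    by (simp add: summable_const_iff)
qed

lemma sm_value_Un:
  assumes "A \<in> sets borel" "B \<in> sets borel" "A \<inter> B = {}"
  shows "sm_value \<nu> (A \<union> B) = sm_value \<nu> A + sm_value \<nu> B"
proof -
  have "(\<lambda>i. sm_value \<nu> (binaryset A B i)) sums sm_value \<nu> (\<Union>i. binaryset A B i)"
    using assms
    by (intro sm_value_sums) (auto simp: binaryset_def disjoint_family_on_def split: if_splits)
  moreover have "(\<lambda>i. sm_value \<nu> (binaryset A B i)) sums (sm_value \<nu> A + sm_value \<nu> B)"
    by (rule binaryset_sums) simp
  ultimately show ?thesis
    by (simp add: UN_binaryset_eq sums_unique2)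
qed

lemma sets_sm_pos [simp, measurable_cong]: "sets (sm_pos \<nu>) = sets borel"
  using sets.sigma_sets_eq [of borel] by (simp add: sm_pos_def)

lemma space_sm_pos [simp]: "space (sm_pos \<nu>) = UNIV"
  using sets_eq_imp_space_eq [OF sets_sm_pos] by simp

lemma emeasure_sm_pos:
  assumes A: "A \<in> sets borel"
  shows "emeasure (sm_pos \<nu>) A = (SUP B \<in> {B \<in> sets borel. B \<subseteq> A}. ennreal (sm_value \<nu> B))"
proof -
  define F where "F A = (SUP B \<in> {B \<in> sets borel. B \<subseteq> A}. ennreal (sm_value \<nu> B))" for A
  have F_upper: "ennreal (sm_value \<nu> B) \<le> F A" if "B \<in> sets borel" "B \<subseteq> A" for A B
    unfolding F_def using that by (intro SUP_upper) auto
  have F_mono: "F C \<le> F D" if "C \<subseteq> D" for C D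
    unfolding F_def using that by (intro SUP_subset_mono) auto
  have F_add: "F A + F B \<le> F (A \<union> B)" if "A \<inter> B = {}" for A B
  proof -
    have "ennreal (sm_value \<nu> C) + ennreal (sm_value \<nu> D) \<le> F (A \<union> B)"
      if "C \<in> sets borel" "C \<subseteq> A" "D \<in> sets borel" "D \<subseteq> B" for C D
    proof -
      have "ennreal (sm_value \<nu> C) \<le> F (A \<union> B)" "ennreal (sm_value \<nu> D) \<le> F (A \<union> B)"
        using that by (auto intro: F_upper)
      moreover have "ennreal (sm_value \<nu> C + sm_value \<nu> D) \<le> F (A \<union> B)"
        using that \<open>A \<inter> B = {}\<close> F_upper [of "C \<union> D" "A \<union> B"]
        by (subst sm_value_Un [symmetric]) auto
      ultimately show ?thesis
        by (cases "0 \<le> sm_value \<nu> C"; cases "0 \<le> sm_value \<nu> D") (auto simp: ennreal_neg)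
    qed
    then have "F A + ennreal (sm_value \<nu> D) \<le> F (A \<union> B)" if "D \<in> sets borel" "D \<subseteq> B" for D
      unfolding F_def [of A] using that
      by (subst ennreal_SUP_add_left [symmetric]) (auto intro!: SUP_least)
    then show ?thesis
      unfolding F_def [of B]
      by (subst ennreal_SUP_add_right) (auto intro!: SUP_least)
  qed
  have F_empty: "F {} = 0"
    by (auto simp: F_def intro!: antisym SUP_least)
  have "countably_additive (sets borel) F"
  proof (rule countably_additiveI)
    fix A :: "nat \<Rightarrow> 'a set"
    assume A: "range A \<subseteq> sets borel" "disjoint_family A" "\<Union> (range A) \<in> sets borel"
    have "(\<Sum>i<n. F (A i)) \<le> F (\<Union>i<n. A i)" for n
    proof (induction n)
      case 0
      then show ?case
        by simp
    next
      case (Suc n)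
      have "(\<Union>i<n. A i) \<inter> A n = {}"
      proof -
        have "A i \<inter> A n = {}" if "i < n" for i
          using A(2) that unfolding disjoint_family_on_def by (metis UNIV_I less_irrefl)
        then show ?thesis
          by blast
      qed
      have "(\<Sum>i<Suc n. F (A i)) \<le> F (\<Union>i<n. A i) + F (A n)"
        unfolding sum.lessThan_Suc by (rule add_right_mono) (rule Suc)
      also have "\<dots> \<le> F ((\<Union>i<n. A i) \<union> A n)"
        by (rule F_add) fact
      also have "(\<Union>i<n. A i) \<union> A n = (\<Union>i<Suc n. A i)"
        by (simp add: lessThan_Suc Un_commute)
      finally show ?case .
    qed
    then have "(\<Sum>i<n. F (A i)) \<le> F (\<Union>i. A i)" for n
      by (rule order_trans) (auto intro!: F_mono)
    then have 1: "(\<Sum>i. F (A i)) \<le> F (\<Union>i. A i)"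
      by (simp add: suminf_le_const)
    have "ennreal (sm_value \<nu> B) \<le> (\<Sum>i. F (A i))" if B: "B \<in> sets borel" "B \<subseteq> (\<Union>i. A i)" for B
    proof -
      have "(\<lambda>i. sm_value \<nu> (B \<inter> A i)) sums sm_value \<nu> (\<Union>i. B \<inter> A i)"
        using A B by (intro sm_value_sums) (auto simp: disjoint_family_on_def)
      moreover have "(\<Union>i. B \<inter> A i) = B"
        using B by auto
      ultimately have "(\<lambda>n. \<Sum>i<n. sm_value \<nu> (B \<inter> A i)) \<longlonglongrightarrow> sm_value \<nu> B"
        by (simp add: sums_def)
      then have "(\<lambda>n. ennreal (\<Sum>i<n. sm_value \<nu> (B \<inter> A i))) \<longlonglongrightarrow> ennreal (sm_value \<nu> B)"
        by (rule tendsto_ennrealI)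
      moreover have "ennreal (\<Sum>i<n. sm_value \<nu> (B \<inter> A i)) \<le> (\<Sum>i. F (A i))" for n
      proof -
        have "ennreal (\<Sum>i<n. sm_value \<nu> (B \<inter> A i)) \<le> ennreal (\<Sum>i<n. max 0 (sm_value \<nu> (B \<inter> A i)))"
          by (intro ennreal_leI sum_mono) auto
        also have "\<dots> = (\<Sum>i<n. ennreal (sm_value \<nu> (B \<inter> A i)))"
          by (subst sum_ennreal [symmetric]) (auto simp: ennreal_max_0)
        also have "\<dots> \<le> (\<Sum>i<n. F (A i))"
          using A B by (intro sum_mono F_upper) auto
        also have "\<dots> \<le> (\<Sum>i. F (A i))"
          by (intro sum_le_suminf) auto
        finally show ?thesis .
      qed
      ultimately show ?thesis
        by (intro LIMSEQ_le_const2) auto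
    qed
    then have "F (\<Union>i. A i) \<le> (\<Sum>i. F (A i))"
      unfolding F_def [of "\<Union>i. A i"] by (auto intro!: SUP_least)
    with 1 show "(\<Sum>i. F (A i)) = F (\<Union> (range A))"
      by (intro antisym) auto
  qed
  moreover have "positive (sets borel) F"
    by (simp add: positive_def F_empty)
  moreover have "sm_pos \<nu> = measure_of UNIV (sets borel) F"
    unfolding sm_pos_def F_def ..
  ultimately show ?thesis
    using assms by (simp add: emeasure_measure_of_sigma sets.sigma_algebra_axioms [of borel, simplified] F_def)
qed

section \<open>Lower semicontinuity and directional derivatives\<close>

definition lower_semicontinuous_map :: "'a topology \<Rightarrow> ('a \<Rightarrow> real) \<Rightarrow> bool" where
  "lower_semicontinuous_map X f \<longleftrightarrow> (\<forall>a. openin X {x \<in> topspace X. a < f x})"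

text \<open>The domain \<open>D\<close> of \<open>f\<close> need not be open: \<open>u + t h\<close> only has to lie in \<open>D\<close> for small \<open>t > 0\<close>.\<close>

definition has_dir_deriv ::
    "'a::real_vector set \<Rightarrow> ('a \<Rightarrow> 'b::real_normed_vector) \<Rightarrow> 'a \<Rightarrow> 'a \<Rightarrow> 'b \<Rightarrow> bool" where
  "has_dir_deriv D f u h d \<longleftrightarrow>
     u \<in> D \<and> (\<forall>\<^sub>F t in at_right 0. u + t *\<^sub>R h \<in> D) \<and>
     ((\<lambda>t. (f (u + t *\<^sub>R h) - f u) /\<^sub>R t) \<longlongrightarrow> d) (at_right 0)"

definition dir_differentiable ::
    "'a::real_vector set \<Rightarrow> ('a \<Rightarrow> 'b::real_normed_vector) \<Rightarrow> 'a \<Rightarrow> 'a \<Rightarrow> bool" where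
  "dir_differentiable D f u h \<longleftrightarrow> (\<exists>d. has_dir_deriv D f u h d)"

definition dir_deriv ::
    "'a::real_vector set \<Rightarrow> ('a \<Rightarrow> 'b::real_normed_vector) \<Rightarrow> 'a \<Rightarrow> 'a \<Rightarrow> 'b" where
  "dir_deriv D f u h = (THE d. has_dir_deriv D f u h d)"

section \<open>Reinsurance treaties\<close>

text \<open>The order on \<open>real ^ 'n\<close> is the componentwise one, so \<open>{0..}\<close> is the nonnegative orthant and
  \<open>{0..x}\<close> is the box \<open>[0, x]\<close>.\<close>

definition state_space :: "((real ^ 'n) \<times> (real ^ 'n)) set" where
  "state_space = {0..} \<times> {0..}"

definition reinsurance_region :: "((real ^ 'n) \<times> (real ^ 'n)) set" where
  "reinsurance_region = {(x, y). 0 \<le> y \<and> y \<le> x}"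

text \<open>Borel measures on the closed orthants are represented by the Borel measures on the whole
  space that are concentrated there.\<close>

definition claim_distribution :: "(real ^ 'n) measure \<Rightarrow> bool" where
  "claim_distribution \<mu> \<longleftrightarrow>
     prob_space \<mu> \<and> sets \<mu> = sets borel \<and> measure \<mu> {0..} = 1 \<and>
     absolutely_continuous lborel \<mu> \<and>
     (\<forall>i. integrable (distr \<mu> borel (\<lambda>x. x $ i)) (\<lambda>s. s))"

definition treaties :: "(real ^ 'n) measure \<Rightarrow> ((real ^ 'n) \<times> (real ^ 'n)) signed_measure set" where
  "treaties \<mu> = sm_of_measure `
     {\<eta>. prob_space \<eta> \<and> sets \<eta> = sets borel \<and> measure \<eta> state_space = 1 \<and>
         distr \<eta> borel fst = \<mu> \<and> measure \<eta> reinsurance_region = 1}"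

end

theory Submission
  imports Defs
begin

text \<open>Put \<open>f = r p + \<lambda> \<cdot> g\<close> and let \<open>\<eta>\<close> be the optimal treaty. By the integral representation of
  the derivatives, the multiplier condition says that \<open>\<integral> f d(\<eta>' - \<eta>) \<ge> 0\<close> for every treaty
  \<open>\<eta>'\<close>. If \<open>\<eta>\<close> put mass on points \<open>(x, y)\<close> where \<open>y\<close> does not minimise \<open>f (x, \<cdot>)\<close> over the box
  \<open>[0, x]\<close>, moving that mass within the fibres to better points would yield a treaty that violates
  this inequality.

  To move mass measurably, the competitors are taken of the form \<open>y = q x\<close> (componentwise product)
  with \<open>q\<close> in a countable dense subset \<open>Q\<close> of the unit cube. As \<open>q\<close> ranges over the cube, \<open>q x\<close>
  ranges over the whole box \<open>[0, x]\<close>; so, \<open>f\<close> being continuous, \<open>y\<close> is a minimiser as soon as no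
  \<open>q \<in> Q\<close> does better (\<open>quota_share_improvement\<close>). Hence the exceptional set is the countable union
  of the Borel sets \<open>A q\<close> of those \<open>(x, y)\<close> in the reinsurance region with
  \<open>f (x, q x) < f (x, y)\<close>, and it suffices to show \<open>\<eta> (A q \<inter> C) = 0\<close> for each \<open>q \<in> Q\<close> and each set \<open>C\<close> of a countable exhaustion by compact boxes.
  Let \<open>T\<close> send \<open>(x, y)\<close> to \<open>(x, q x)\<close> on \<open>A q \<inter> C\<close> and fix all other points. The image of \<open>\<eta>\<close>
  under \<open>T\<close> is again a treaty (\<open>treaty_pushforward\<close>), and \<open>\<integral> f d(T\<eta> - \<eta>)\<close> is the integral of
  \<open>f (x, q x) - f (x, y) < 0\<close> over \<open>A q \<inter> C\<close> (\<open>sm_integral_reroute_neg\<close>).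

  The function \<open>f\<close> may fail to be integrable with respect to \<open>\<eta>\<close> itself; only integrals over
  differences of treaties are under control. This is the reason for the cut-off \<open>C\<close>: the signed
  measure \<open>T\<eta> - \<eta>\<close> lives on \<open>C\<close>, where \<open>f\<close> is bounded, and there the integral defined through the
  Jordan decomposition splits into two ordinary ones (\<open>sm_integral_diff_concentrated\<close>).\<close>

section \<open>Jordan decomposition of a difference of finite measures\<close>

lemma sm_value_sm_of_measure:
  assumes "finite_measure M" "sets M = sets borel"
  shows "sm_value (sm_of_measure M) A = measure M A"
  using assms by transfer simp

lemma sm_value_diff: "sm_value (\<mu> - \<nu>) A = sm_value \<mu> A - sm_value \<nu> A"
  by transfer simp

lemma sm_value_uminus: "sm_value (- \<nu>) A = - sm_value \<nu> A"
  by transfer simp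

lemma sm_pos_null:
  assumes "A \<in> sets borel"
    and "\<And>B. B \<in> sets borel \<Longrightarrow> B \<subseteq> A \<Longrightarrow> sm_value \<nu> B = 0"
  shows "emeasure (sm_pos \<nu>) A = 0"
proof -
  have "emeasure (sm_pos \<nu>) A \<le> 0"
    unfolding emeasure_sm_pos[OF assms(1)] using assms(2) by (intro SUP_least) auto
  then show ?thesis by simp
qed

lemma sm_pos_diff_le:
  assumes M: "finite_measure M" "sets M = sets borel"
    and N: "finite_measure N" "sets N = sets borel"
    and A: "A \<in> sets borel"
  shows "emeasure (sm_pos (sm_of_measure M - sm_of_measure N)) A \<le> emeasure M A"
  unfolding emeasure_sm_pos[OF A]
proof (rule SUP_least)
  fix B assume B: "B \<in> {B \<in> sets borel. B \<subseteq> A}"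
  have "sm_value (sm_of_measure M - sm_of_measure N) B \<le> measure M B"
    using M N by (simp add: sm_value_diff sm_value_sm_of_measure)
  also have "\<dots> \<le> measure M A"
    using B A M by (intro finite_measure.finite_measure_mono) auto
  finally show "ennreal (sm_value (sm_of_measure M - sm_of_measure N) B) \<le> emeasure M A"
    by (simp add: finite_measure.emeasure_eq_measure[OF M(1)] ennreal_leI)
qed

lemma sm_neg_diff: "sm_neg (\<mu> - \<nu>) = sm_pos (\<nu> - \<mu>)"
  by (simp add: sm_neg_def)

text \<open>With \<open>\<nu> = M - N\<close>, a Borel set \<open>B \<subseteq> A\<close> satisfies
  \<open>\<nu> B + N A = - \<nu> (A - B) + M A\<close>. So a set competing in the supremum for \<open>\<nu>\<^sup>+ A\<close> yields, by
  complementation in \<open>A\<close>, one competing in the supremum for \<open>\<nu>\<^sup>- A\<close>.\<close>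

lemma sm_pos_diff_add_le:
  assumes M: "finite_measure M" "sets M = sets borel"
    and N: "finite_measure N" "sets N = sets borel"
    and A: "A \<in> sets borel"
  shows "emeasure (sm_pos (sm_of_measure M - sm_of_measure N)) A + emeasure N A
    \<le> emeasure (sm_pos (sm_of_measure N - sm_of_measure M)) A + emeasure M A"
proof -
  define \<nu> where "\<nu> = sm_of_measure M - sm_of_measure N"
  define \<nu>' where "\<nu>' = sm_of_measure N - sm_of_measure M"
  have val: "sm_value \<nu> B = measure M B - measure N B"
    "sm_value \<nu>' B = measure N B - measure M B" for B
    using M N by (simp_all add: \<nu>_def \<nu>'_def sm_value_diff sm_value_sm_of_measure)
  have bound: "ennreal (sm_value \<nu> B + measure N A) \<le> emeasure (sm_pos \<nu>') A + emeasure M A"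
    if B: "B \<in> sets borel" "B \<subseteq> A" for B
  proof -
    have "measure M (A - B) = measure M A - measure M B"
      using B A M by (intro finite_measure.finite_measure_Diff) auto
    moreover have "measure N (A - B) = measure N A - measure N B"
      using B A N by (intro finite_measure.finite_measure_Diff) auto
    ultimately have "sm_value \<nu> B + measure N A = sm_value \<nu>' (A - B) + measure M A"
      by (simp add: val)
    also have "ennreal \<dots> \<le> ennreal (sm_value \<nu>' (A - B)) + ennreal (measure M A)"
      by (cases "0 \<le> sm_value \<nu>' (A - B)") (auto simp: ennreal_neg intro: ennreal_leI)
    also have "\<dots> \<le> emeasure (sm_pos \<nu>') A + emeasure M A"
      using A B by (auto simp: finite_measure.emeasure_eq_measure[OF M(1)] emeasure_sm_pos
          intro!: add_right_mono SUP_upper)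
    finally show ?thesis .
  qed
  \<comment> \<open>\<open>ennreal\<close> truncates negative values to 0, where the bound for the empty set takes over.\<close>
  have "ennreal (sm_value \<nu> B) + ennreal (measure N A) \<le> emeasure (sm_pos \<nu>') A + emeasure M A"
    if B: "B \<in> sets borel" "B \<subseteq> A" for B
    using bound[OF B] bound[of "{}"]
    by (cases "0 \<le> sm_value \<nu> B") (auto simp: ennreal_neg)
  then have "emeasure (sm_pos \<nu>) A + ennreal (measure N A)
      \<le> emeasure (sm_pos \<nu>') A + emeasure M A"
    unfolding emeasure_sm_pos[OF A, of \<nu>]
    by (subst ennreal_SUP_add_left[symmetric]) (auto intro!: SUP_least)
  then show ?thesis
    by (simp add: \<nu>_def \<nu>'_def finite_measure.emeasure_eq_measure[OF N(1)])
qed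

text \<open>This is \<open>\<nu>\<^sup>+ - \<nu>\<^sup>- = M - N\<close>, written without subtraction so that it makes sense in \<open>ennreal\<close>
  and carries over to integrals.\<close>

lemma emeasure_jordan_balance:
  assumes "finite_measure M" "sets M = sets borel"
    and "finite_measure N" "sets N = sets borel"
    and "A \<in> sets borel"
  defines "\<nu> \<equiv> sm_of_measure M - sm_of_measure N"
  shows "emeasure (sm_pos \<nu>) A + emeasure N A = emeasure (sm_neg \<nu>) A + emeasure M A"
  using sm_pos_diff_add_le[OF assms(1-5)] sm_pos_diff_add_le[OF assms(3,4,1,2,5)]
  by (auto simp: \<nu>_def sm_neg_diff intro!: antisym)

section \<open>Integrals against a difference of finite measures\<close>

text \<open>Both sides are additive and monotonically continuous in the integrand, so it is enough that
  they agree on indicator functions.\<close>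

lemma nn_integral_balance:
  assumes sets: "sets M1 = sets M" "sets M2 = sets M" "sets M3 = sets M" "sets M4 = sets M"
    and bal: "\<And>A. A \<in> sets M \<Longrightarrow>
      emeasure M1 A + emeasure M2 A = emeasure M3 A + emeasure M4 A"
    and f: "f \<in> borel_measurable M"
  shows "nn_integral M1 f + nn_integral M2 f = nn_integral M3 f + nn_integral M4 f"
proof -
  have meas: "borel_measurable M1 = (borel_measurable M :: ('a \<Rightarrow> ennreal) set)"
    "borel_measurable M2 = (borel_measurable M :: ('a \<Rightarrow> ennreal) set)"
    "borel_measurable M3 = (borel_measurable M :: ('a \<Rightarrow> ennreal) set)"
    "borel_measurable M4 = (borel_measurable M :: ('a \<Rightarrow> ennreal) set)"
    using sets by (auto cong: measurable_cong_sets)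
  have sp: "space M1 = space M" "space M2 = space M" "space M3 = space M" "space M4 = space M"
    using sets by (auto dest: sets_eq_imp_space_eq)
  show ?thesis
    using f
  proof (induction rule: borel_measurable_induct)
    case (cong f g)
    then have "nn_integral M1 f = nn_integral M1 g" "nn_integral M2 f = nn_integral M2 g"
      "nn_integral M3 f = nn_integral M3 g" "nn_integral M4 f = nn_integral M4 g"
      by (auto intro!: nn_integral_cong simp: sp)
    with cong show ?case by simp
  next
    case (set A)
    then show ?case by (simp add: sets bal)
  next
    case (mult u c)
    then show ?case by (simp add: nn_integral_cmult meas distrib_left[symmetric])
  next
    case (add u v)
    then show ?case by (simp add: nn_integral_add meas ac_simps)
  next
    case (seq U)
    have inc: "incseq (\<lambda>i. nn_integral K (U i))" for K :: "'a measure"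
      using seq by (auto simp: incseq_def le_fun_def intro!: nn_integral_mono)
    have SUP: "nn_integral K (SUP i. U i) = (SUP i. nn_integral K (U i))"
      if "borel_measurable K = (borel_measurable M :: ('a \<Rightarrow> ennreal) set)" for K
      unfolding SUP_apply[abs_def] using seq that
      by (intro nn_integral_monotone_convergence_SUP) auto
    show ?case
      unfolding SUP[OF meas(1)] SUP[OF meas(2)] SUP[OF meas(3)] SUP[OF meas(4)]
      by (simp only: ennreal_SUP_add[OF inc inc, symmetric] seq.IH)
  qed
qed

lemma integral_balance:
  fixes f :: "'a \<Rightarrow> real"
  assumes sets: "sets M1 = sets M" "sets M2 = sets M" "sets M3 = sets M" "sets M4 = sets M"
    and bal: "\<And>A. A \<in> sets M \<Longrightarrow>
      emeasure M1 A + emeasure M2 A = emeasure M3 A + emeasure M4 A"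
    and int: "integrable M1 f" "integrable M2 f" "integrable M3 f" "integrable M4 f"
  shows "integral\<^sup>L M1 f + integral\<^sup>L M2 f = integral\<^sup>L M3 f + integral\<^sup>L M4 f"
proof -
  have f: "f \<in> borel_measurable M"
    using borel_measurable_integrable[OF int(1)] sets(1) by (simp cong: measurable_cong_sets)
  have fin: "(\<integral>\<^sup>+x. ennreal (f x) \<partial>N) < \<top>" "(\<integral>\<^sup>+x. ennreal (- f x) \<partial>N) < \<top>"
    if "integrable N f" for N
    using that by (auto simp: real_integrable_def less_top)
  have key: "enn2real (\<integral>\<^sup>+x. ennreal (g x) \<partial>M1) + enn2real (\<integral>\<^sup>+x. ennreal (g x) \<partial>M2)
     = enn2real (\<integral>\<^sup>+x. ennreal (g x) \<partial>M3) + enn2real (\<integral>\<^sup>+x. ennreal (g x) \<partial>M4)"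
    if "g \<in> borel_measurable M" "(\<integral>\<^sup>+x. ennreal (g x) \<partial>M1) < \<top>" "(\<integral>\<^sup>+x. ennreal (g x) \<partial>M2) < \<top>"
     "(\<integral>\<^sup>+x. ennreal (g x) \<partial>M3) < \<top>" "(\<integral>\<^sup>+x. ennreal (g x) \<partial>M4) < \<top>" for g :: "'a \<Rightarrow> real"
    using nn_integral_balance[OF sets bal, of "\<lambda>x. ennreal (g x)"] that
    by (simp add: enn2real_plus[symmetric])
  have "(\<lambda>x. - f x) \<in> borel_measurable M" using f by simp
  from key[OF f] key[OF this] fin int
  show ?thesis by (simp add: real_lebesgue_integral_def)
qed

lemma AE_sm_pos_in:
  assumes "K \<in> sets borel"
    and "\<And>B. B \<in> sets borel \<Longrightarrow> B \<inter> K = {} \<Longrightarrow> sm_value \<nu> B = 0"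
  shows "AE z in sm_pos \<nu>. z \<in> K"
  using assms by (intro AE_I[where N = "- K"] sm_pos_null) auto

lemma integrable_indicator_bounded:
  fixes f :: "'a::topological_space \<Rightarrow> real"
  assumes L: "finite_measure L" "sets L = sets borel"
    and K: "K \<in> sets borel" "K \<subseteq> D"
    and f: "set_borel_measurable borel D f" and bdd: "bounded (f ` K)"
  shows "integrable L (\<lambda>z. indicator K z * f z)"
proof -
  have "(\<lambda>z. indicator K z * f z) = (\<lambda>z. indicator K z *\<^sub>R (indicator D z *\<^sub>R f z))"
    using K by (auto simp: fun_eq_iff indicator_def)
  also have "\<dots> \<in> borel_measurable borel"
    using f K unfolding set_borel_measurable_def by measurable
  finally have meas: "(\<lambda>z. indicator K z * f z) \<in> borel_measurable L"
    using L(2) by (simp cong: measurable_cong_sets)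
  obtain c where c: "\<And>z. z \<in> K \<Longrightarrow> \<bar>f z\<bar> \<le> c"
    using bdd by (auto simp: bounded_iff)
  have "\<bar>indicator K z * f z\<bar> \<le> \<bar>c\<bar>" for z
    using c[of z] by (auto simp: indicator_def)
  then show ?thesis
    using L(1) meas by (intro finite_measure.integrable_const_bound[where B = "\<bar>c\<bar>"]) auto
qed

text \<open>Outside \<open>K\<close> both parts of the Jordan decomposition vanish, and \<open>f\<close> is bounded on \<open>K\<close>; so all
  four integrals in \<open>integral_balance\<close>, taken over \<open>K\<close>, are finite and can be rearranged.\<close>

lemma sm_integral_diff_concentrated:
  fixes f :: "'a::topological_space \<Rightarrow> real"
  assumes M: "finite_measure M" "sets M = sets borel"
    and N: "finite_measure N" "sets N = sets borel"
    and D: "D \<in> sets borel" and K: "K \<in> sets borel" "K \<subseteq> D"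
    and eq: "\<And>B. B \<in> sets borel \<Longrightarrow> B \<inter> K = {} \<Longrightarrow> measure M B = measure N B"
    and f: "set_borel_measurable borel D f" and bdd: "bounded (f ` K)"
  shows "sm_integral (sm_of_measure M - sm_of_measure N) D f
    = set_lebesgue_integral M K f - set_lebesgue_integral N K f"
proof -
  define \<nu> where "\<nu> = sm_of_measure M - sm_of_measure N"
  define h where "h = (\<lambda>z. indicator K z * f z)"
  have val: "sm_value \<nu> B = measure M B - measure N B" for B
    using M N by (simp add: \<nu>_def sm_value_diff sm_value_sm_of_measure)
  have finp: "finite_measure (sm_pos (sm_of_measure M - sm_of_measure N))"
    if "finite_measure M" "sets M = sets borel" "finite_measure N" "sets N = sets borel"
    for M N :: "'a measure"
  proof
    have "emeasure (sm_pos (sm_of_measure M - sm_of_measure N)) UNIV \<le> emeasure M UNIV"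
      using that by (intro sm_pos_diff_le) auto
    then show "emeasure (sm_pos (sm_of_measure M - sm_of_measure N))
        (space (sm_pos (sm_of_measure M - sm_of_measure N))) \<noteq> \<infinity>"
      using finite_measure.emeasure_finite[OF that(1), of UNIV] by (auto simp: top_unique)
  qed
  have sets: "sets (sm_pos \<nu>) = sets borel" "sets (sm_neg \<nu>) = sets borel"
    by (simp_all add: sm_neg_def)
  have int: "integrable L h" if "finite_measure L" "sets L = sets borel" for L
    unfolding h_def using that K f bdd by (rule integrable_indicator_bounded)
  have h_meas: "h \<in> borel_measurable borel"
    using borel_measurable_integrable[OF int[OF N]] N(2) by (simp cong: measurable_cong_sets)
  have "integral\<^sup>L (sm_pos \<nu>) h + integral\<^sup>L N h = integral\<^sup>L (sm_neg \<nu>) h + integral\<^sup>L M h"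
  proof (rule integral_balance)
    show "emeasure (sm_pos \<nu>) A + emeasure N A = emeasure (sm_neg \<nu>) A + emeasure M A"
      if "A \<in> sets borel" for A
      unfolding \<nu>_def using that M N by (intro emeasure_jordan_balance)
    show "integrable (sm_pos \<nu>) h" "integrable (sm_neg \<nu>) h"
      unfolding \<nu>_def sm_neg_diff by (intro int finp M N sets_sm_pos)+
  qed (intro int M N sets)+
  moreover have "set_lebesgue_integral (sm_pos \<kappa>) D f = integral\<^sup>L (sm_pos \<kappa>) h"
    if "\<And>B. B \<in> sets borel \<Longrightarrow> B \<inter> K = {} \<Longrightarrow> sm_value \<kappa> B = 0" for \<kappa>
  proof -
    have "AE z in sm_pos \<kappa>. z \<in> K"
      using K that by (intro AE_sm_pos_in) auto
    then have "AE z in sm_pos \<kappa>. indicator D z *\<^sub>R f z = h z"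
      by eventually_elim (use K in \<open>auto simp: h_def indicator_def\<close>)
    then show ?thesis
      unfolding set_lebesgue_integral_def using f h_meas
      by (intro integral_cong_AE) (auto simp: set_borel_measurable_def cong: measurable_cong_sets)
  qed
  from this[of \<nu>] this[of "- \<nu>"] eq
  have "set_lebesgue_integral (sm_pos \<nu>) D f = integral\<^sup>L (sm_pos \<nu>) h"
    "set_lebesgue_integral (sm_neg \<nu>) D f = integral\<^sup>L (sm_neg \<nu>) h"
    by (auto simp: val sm_value_uminus sm_neg_def)
  ultimately show ?thesis
    by (simp add: sm_integral_def \<nu>_def h_def set_lebesgue_integral_def)
qed

lemma sm_integral_linear_functional:
  fixes p :: "'a::topological_space \<Rightarrow> real" and g :: "'a \<Rightarrow> 'b::euclidean_space"
  assumes "sm_integrable_on \<nu> D p" "sm_integrable_on \<nu> D g"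
  shows "sm_integral \<nu> D (\<lambda>z. r * p z + l \<bullet> g z) = r * sm_integral \<nu> D p + l \<bullet> sm_integral \<nu> D g"
proof -
  have "set_lebesgue_integral L D (\<lambda>z. r * p z + l \<bullet> g z)
      = r * set_lebesgue_integral L D p + l \<bullet> set_lebesgue_integral L D g"
    if "set_integrable L D p" "set_integrable L D g" for L
  proof -
    have p: "integrable L (\<lambda>z. indicator D z *\<^sub>R p z)"
      and g: "integrable L (\<lambda>z. indicator D z *\<^sub>R g z)"
      using that by (simp_all add: set_integrable_def)
    have "(\<lambda>z. indicator D z *\<^sub>R (r * p z + l \<bullet> g z))
      = (\<lambda>z. r * (indicator D z *\<^sub>R p z) + l \<bullet> (indicator D z *\<^sub>R g z))"
      by (auto simp: indicator_def fun_eq_iff)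
    moreover have "(\<integral>z. r * (indicator D z *\<^sub>R p z) + l \<bullet> (indicator D z *\<^sub>R g z) \<partial>L)
      = (\<integral>z. r * (indicator D z *\<^sub>R p z) \<partial>L) + (\<integral>z. l \<bullet> (indicator D z *\<^sub>R g z) \<partial>L)"
      using p g by (intro Bochner_Integration.integral_add integrable_mult_right integrable_inner_right)
    ultimately show ?thesis
      unfolding set_lebesgue_integral_def
      by (simp only: integral_mult_right_zero integral_inner_right[OF g])
  qed
  with assms show ?thesis
    by (simp add: sm_integral_def sm_integrable_on_def inner_diff_right algebra_simps)
qed

text \<open>Transporting mass from \<open>A\<close> to points where \<open>f\<close> is smaller lowers the integral of \<open>f\<close>. As \<open>T\<close>
  only moves points within \<open>K\<close>, the measure \<open>N\<close> and its image agree off \<open>K\<close>, which makes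
  \<open>sm_integral_diff_concentrated\<close> applicable.\<close>

lemma sm_integral_reroute_neg:
  fixes f :: "'a::topological_space \<Rightarrow> real"
  assumes N: "finite_measure N" "sets N = sets borel"
    and T: "T \<in> borel_measurable borel" and A: "A \<in> sets borel" "measure N A > 0"
    and id: "\<And>z. z \<notin> A \<Longrightarrow> T z = z" and less: "\<And>z. z \<in> A \<Longrightarrow> f (T z) < f z"
    and K: "K \<in> sets borel" "A \<subseteq> K" "T ` A \<subseteq> K"
    and D: "D \<in> sets borel" "K \<subseteq> D"
    and f: "set_borel_measurable borel D f" and bdd: "bounded (f ` K)"
  shows "sm_integral (sm_of_measure (distr N borel T) - sm_of_measure N) D f < 0"
proof -
  have TN: "T \<in> measurable N borel" using T N by (simp cong: measurable_cong_sets)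
  have sp: "space N = UNIV" using sets_eq_imp_space_eq[OF N(2)] by simp
  have fin: "finite_measure (distr N borel T)"
    using N(1) TN by (rule finite_measure.finite_measure_distr)
  define h where "h = (\<lambda>z. indicator K z * f z)"
  have int: "integrable N h" "integrable (distr N borel T) h"
    unfolding h_def using N fin K D f bdd
    by (intro integrable_indicator_bounded[where D = D]; simp)+
  have h_meas: "h \<in> borel_measurable borel"
    using borel_measurable_integrable[OF int(2)] by simp
  have intT: "integrable N (\<lambda>z. h (T z))"
    using TN int(2) by (rule integrable_distr)
  \<comment> \<open>Off \<open>K\<close> nothing moves: the points of \<open>A\<close> lie in \<open>K\<close> and stay there.\<close>
  have "sm_integral (sm_of_measure (distr N borel T) - sm_of_measure N) D f
    = set_lebesgue_integral (distr N borel T) K f - set_lebesgue_integral N K f"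
  proof (rule sm_integral_diff_concentrated)
    fix B :: "'a set" assume B: "B \<in> sets borel" "B \<inter> K = {}"
    have "z \<in> T -` B \<longleftrightarrow> z \<in> B" for z
      using B K id[of z] by (cases "z \<in> A") auto
    then have "T -` B = B" by auto
    then show "measure (distr N borel T) B = measure N B"
      using B TN sp by (simp add: measure_distr)
  qed (use fin N K D f bdd in auto)
  also have "\<dots> = (\<integral>z. h (T z) \<partial>N) - (\<integral>z. h z \<partial>N)"
    using TN h_meas by (simp add: set_lebesgue_integral_def h_def integral_distr)
  also have "\<dots> < 0"
  proof -
    have le: "h (T z) \<le> h z" for z
      using id[of z] less[of z] K by (cases "z \<in> A") (auto simp: h_def indicator_def)
    have "(\<integral>z. h (T z) \<partial>N) < (\<integral>z. h z \<partial>N)"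
    proof (rule finite_measure.integral_less_AE[OF N(1) intT int(1), of A])
      show "emeasure N A \<noteq> 0" using A(2) by (auto simp: measure_def)
      show "AE z in N. z \<in> A \<longrightarrow> h (T z) \<noteq> h z"
      proof (intro AE_I2 impI)
        fix z assume "z \<in> A"
        then show "h (T z) \<noteq> h z"
          using less[of z] K by (auto simp: h_def indicator_def)
      qed
    qed (use A N le in auto)
    then show ?thesis by simp
  qed
  finally show ?thesis .
qed

section \<open>Quota-share treaties\<close>

text \<open>In reinsurance, ceding a fixed proportion \<open>q $ i\<close> of each claim \<open>x $ i\<close> is called a
  quota-share contract.\<close>

definition quota_share :: "real ^ 'n \<Rightarrow> real ^ 'n \<Rightarrow> real ^ 'n" where
  "quota_share q x = (\<chi> i. q $ i * x $ i)"

lemma quota_share_bounds: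
  assumes "q \<in> {0..1}" "0 \<le> x"
  shows "0 \<le> quota_share q x" "quota_share q x \<le> x"
proof -
  have "0 \<le> q $ i" "q $ i \<le> 1" "0 \<le> x $ i" for i
    using assms by (simp_all add: less_eq_vec_def)
  then show "0 \<le> quota_share q x" "quota_share q x \<le> x"
    by (simp_all add: quota_share_def less_eq_vec_def mult_left_le_one_le)
qed

lemma quota_share_surj:
  assumes "0 \<le> z" "z \<le> x"
  obtains q where "q \<in> {0..1}" "quota_share q x = z"
proof
  have z: "0 \<le> z $ i" "z $ i \<le> x $ i" for i
    using assms by (auto simp: less_eq_vec_def)
  \<comment> \<open>If \<open>x $ i = 0\<close>, then \<open>z $ i = 0\<close>, and the convention \<open>0 / 0 = 0\<close> gives an admissible proportion.\<close>
  have "0 \<le> z $ i / x $ i \<and> z $ i / x $ i \<le> 1 \<and> z $ i / x $ i * x $ i = z $ i" for i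
    using z[of i] by (cases "x $ i = 0") (auto simp: divide_le_eq_1)
  then show "(\<chi> i. z $ i / x $ i) \<in> {0..1}" "quota_share (\<chi> i. z $ i / x $ i) x = z"
    by (auto simp: quota_share_def less_eq_vec_def vec_eq_iff)
qed

text \<open>The proportion that realises \<open>z\<close> need not lie in \<open>Q\<close>, but it is a limit of elements of \<open>Q\<close>,
  and the strict inequality survives a small perturbation by continuity. This reduces minimality
  over the box to countably many inequalities.\<close>

lemma quota_share_improvement:
  fixes f :: "(real ^ 'n) \<times> (real ^ 'n) \<Rightarrow> real"
  assumes f: "continuous_on state_space f"
    and Q: "Q \<subseteq> {0..1}" "{0..1} \<subseteq> closure Q"
    and z: "0 \<le> z" "z \<le> x" "f (x, z) < a"
  obtains q where "q \<in> Q" "f (x, quota_share q x) < a"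
proof -
  have x: "0 \<le> x" using z(1,2) by (rule order.trans)
  obtain q0 where q0: "q0 \<in> {0..1}" "quota_share q0 x = z"
    using quota_share_surj z by metis
  obtain s where s: "\<And>n. s n \<in> Q" "s \<longlonglongrightarrow> q0"
    using q0(1) Q(2) closure_sequential by blast
  have cont: "continuous_on {0..1} (\<lambda>q. f (x, quota_share q x))"
    using f
  proof (rule continuous_on_compose2)
    show "continuous_on {0..1} (\<lambda>q. (x, quota_share q x))"
      unfolding quota_share_def by (intro continuous_intros)
    show "(\<lambda>q. (x, quota_share q x)) ` {0..1} \<subseteq> state_space"
      using x quota_share_bounds(1)[OF _ x] by (auto simp: state_space_def)
  qed
  have sQ: "s n \<in> {0..1}" for n using s(1) Q(1) by blast
  have "(\<lambda>n. f (x, quota_share (s n) x)) \<longlonglongrightarrow> f (x, quota_share q0 x)"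
    by (intro continuous_on_tendsto_compose[OF cont s(2) q0(1)] always_eventually allI sQ)
  then have "\<forall>\<^sub>F n in sequentially. f (x, quota_share (s n) x) < a"
    using z(3) q0(2) by (intro order_tendstoD) auto
  then obtain n where "f (x, quota_share (s n) x) < a"
    by (auto simp: eventually_sequentially)
  with s that show thesis by blast
qed

section \<open>Modifying a treaty fibrewise\<close>

lemma closed_state_space: "closed (state_space :: ((real ^ 'n) \<times> (real ^ 'n)) set)"
  unfolding state_space_def by (intro closed_Times closed_eucl_atLeast)

lemma closed_reinsurance_region:
  "closed (reinsurance_region :: ((real ^ 'n) \<times> (real ^ 'n)) set)"
proof -
  have "reinsurance_region = (\<Inter>i. {z. 0 \<le> snd z $ i} \<inter>
      {z :: (real ^ 'n) \<times> (real ^ 'n). snd z $ i \<le> fst z $ i})"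
    by (auto simp: reinsurance_region_def less_eq_vec_def)
  also have "closed \<dots>"
    by (intro closed_INT ballI closed_Int closed_Collect_le continuous_intros)
  finally show ?thesis .
qed

text \<open>The first marginal is unchanged because \<open>T\<close> preserves the claim \<open>x\<close>; only the ceded part is
  redistributed.\<close>

lemma treaty_pushforward:
  fixes \<eta> :: "((real ^ 'n) \<times> (real ^ 'n)) measure"
  assumes \<eta>: "prob_space \<eta>" "sets \<eta> = sets borel" "distr \<eta> borel fst = \<mu>"
      "measure \<eta> reinsurance_region = 1"
    and T: "T \<in> borel_measurable borel" "\<And>z. fst (T z) = fst z"
      "\<And>z. z \<in> reinsurance_region \<Longrightarrow> T z \<in> reinsurance_region"
  shows "sm_of_measure (distr \<eta> borel T) \<in> treaties \<mu>"
proof -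
  interpret \<eta>: prob_space \<eta> by fact
  have TN: "T \<in> measurable \<eta> borel" using T \<eta> by (simp cong: measurable_cong_sets)
  interpret \<eta>': prob_space "distr \<eta> borel T" by (rule \<eta>.prob_space_distr[OF TN])
  have sp: "space \<eta> = UNIV" using sets_eq_imp_space_eq[OF \<eta>(2)] by simp
  have ev: "T -` reinsurance_region \<in> sets \<eta>"
    using measurable_sets[OF TN borel_closed[OF closed_reinsurance_region]] sp by simp
  have "1 \<le> measure \<eta> (T -` reinsurance_region)"
    using T(3) ev unfolding \<eta>(4)[symmetric] by (intro \<eta>.finite_measure_mono) blast+
  then have R: "measure (distr \<eta> borel T) reinsurance_region = 1"
    using measure_distr[OF TN borel_closed[OF closed_reinsurance_region]] sp
      \<eta>.prob_le_1[of "T -` reinsurance_region"] by simp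
  have "(reinsurance_region :: ((real ^ 'n) \<times> (real ^ 'n)) set) \<subseteq> state_space"
    by (auto simp: reinsurance_region_def state_space_def)
  then have "1 \<le> measure (distr \<eta> borel T) state_space"
    using \<eta>'.finite_measure_mono[of reinsurance_region state_space] R
      borel_closed[OF closed_state_space] by simp
  then have "measure (distr \<eta> borel T) state_space = 1"
    using \<eta>'.prob_le_1[of state_space] by simp
  moreover have "distr (distr \<eta> borel T) borel fst = \<mu>"
  proof -
    have "fst \<in> measurable borel (borel :: (real ^ 'n) measure)"
      by (intro borel_measurable_continuous_onI continuous_intros)
    then have "distr (distr \<eta> borel T) borel fst = distr \<eta> borel (fst \<circ> T)"
      using TN by (rule distr_distr)
    also have "fst \<circ> T = fst"
      using T(2) by (simp add: fun_eq_iff)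
    finally show ?thesis using \<eta>(3) by simp
  qed
  ultimately show ?thesis
    unfolding treaties_def mem_Collect_eq
    by (intro imageI CollectI conjI R \<eta>'.prob_space_axioms sets_distr)
qed

section \<open>Optimal treaties are concentrated on fibrewise minimisers\<close>

theorem proposition4p7:
  fixes \<mu> :: "(real ^ 'n) measure"
    and P :: "((real ^ 'n) \<times> (real ^ 'n)) signed_measure \<Rightarrow> real"
    and G :: "((real ^ 'n) \<times> (real ^ 'n)) signed_measure \<Rightarrow> real ^ 'm"
    and S :: "((real ^ 'n) \<times> (real ^ 'n)) signed_measure set"
    and \<eta>s :: "((real ^ 'n) \<times> (real ^ 'n)) signed_measure"
    and r :: real and lam :: "real ^ 'm"
    and p :: "(real ^ 'n) \<times> (real ^ 'n) \<Rightarrow> real"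
    and g :: "(real ^ 'n) \<times> (real ^ 'n) \<Rightarrow> real ^ 'm"
  assumes mu: "claim_distribution \<mu>"
    and P_lsc: "lower_semicontinuous_map (subtopology (weak_topology state_space) (treaties \<mu>)) P"
    and G_lsc: "\<And>i. lower_semicontinuous_map
                  (subtopology (weak_topology state_space) (treaties \<mu>)) (\<lambda>\<eta>. G \<eta> $ i)"
    and S_def: "S = {\<eta> \<in> treaties \<mu>. G \<eta> \<le> 0}"
    and S_closed: "closedin (subtopology (weak_topology state_space) (treaties \<mu>)) S"
    and optimal: "\<eta>s \<in> S" "\<And>\<eta>. \<eta> \<in> S \<Longrightarrow> P \<eta>s \<le> P \<eta>"
    and dP_exists: "\<And>\<eta>. \<eta> \<in> treaties \<mu> \<Longrightarrow> dir_differentiable (treaties \<mu>) P \<eta>s (\<eta> - \<eta>s)"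
    and dG_exists: "\<And>\<eta>. \<eta> \<in> treaties \<mu> \<Longrightarrow> dir_differentiable (treaties \<mu>) G \<eta>s (\<eta> - \<eta>s)"
    and dP_affine: "\<And>\<eta>1 \<eta>2 t. \<eta>1 \<in> treaties \<mu> \<Longrightarrow> \<eta>2 \<in> treaties \<mu> \<Longrightarrow> 0 \<le> t \<Longrightarrow> t \<le> 1 \<Longrightarrow>
          dir_deriv (treaties \<mu>) P \<eta>s ((1 - t) *\<^sub>R \<eta>1 + t *\<^sub>R \<eta>2 - \<eta>s) =
            (1 - t) * dir_deriv (treaties \<mu>) P \<eta>s (\<eta>1 - \<eta>s) +
            t * dir_deriv (treaties \<mu>) P \<eta>s (\<eta>2 - \<eta>s)"
    and dG_affine: "\<And>\<eta>1 \<eta>2 t. \<eta>1 \<in> treaties \<mu> \<Longrightarrow> \<eta>2 \<in> treaties \<mu> \<Longrightarrow> 0 \<le> t \<Longrightarrow> t \<le> 1 \<Longrightarrow>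
          dir_deriv (treaties \<mu>) G \<eta>s ((1 - t) *\<^sub>R \<eta>1 + t *\<^sub>R \<eta>2 - \<eta>s) =
            (1 - t) *\<^sub>R dir_deriv (treaties \<mu>) G \<eta>s (\<eta>1 - \<eta>s) +
            t *\<^sub>R dir_deriv (treaties \<mu>) G \<eta>s (\<eta>2 - \<eta>s)"
    and r_nonneg: "0 \<le> r" and lam_nonneg: "0 \<le> lam"
    and complementary: "lam \<bullet> G \<eta>s = 0"
    and multiplier: "\<And>\<eta>. \<eta> \<in> treaties \<mu> \<Longrightarrow>
          0 \<le> r * dir_deriv (treaties \<mu>) P \<eta>s (\<eta> - \<eta>s) +
              lam \<bullet> dir_deriv (treaties \<mu>) G \<eta>s (\<eta> - \<eta>s)"
    and p_cont: "continuous_on state_space p"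
    and g_cont: "continuous_on state_space g"
    and p_integrable: "\<And>\<nu>. \<nu> \<in> (\<lambda>\<eta>. \<eta> - \<eta>s) ` treaties \<mu> \<Longrightarrow> sm_integrable_on \<nu> state_space p"
    and g_integrable: "\<And>\<nu>. \<nu> \<in> (\<lambda>\<eta>. \<eta> - \<eta>s) ` treaties \<mu> \<Longrightarrow> sm_integrable_on \<nu> state_space g"
    and dP_integral: "\<And>\<nu>. \<nu> \<in> (\<lambda>\<eta>. \<eta> - \<eta>s) ` treaties \<mu> \<Longrightarrow>
          dir_deriv (treaties \<mu>) P \<eta>s \<nu> = sm_integral \<nu> state_space p"
    and dG_integral: "\<And>\<nu>. \<nu> \<in> (\<lambda>\<eta>. \<eta> - \<eta>s) ` treaties \<mu> \<Longrightarrow>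
          dir_deriv (treaties \<mu>) G \<eta>s \<nu> = sm_integral \<nu> state_space g"
    and m_measurable: "(\<lambda>x. INF y \<in> {0..x}. r * p (x, y) + lam \<bullet> g (x, y))
          \<in> borel_measurable (restrict_space borel {0..})"
  shows "sm_value \<eta>s
           {(x, y) \<in> reinsurance_region.
              is_arg_min (\<lambda>t. r * p (x, t) + lam \<bullet> g (x, t)) (\<lambda>t. t \<in> {0..x}) y} = 1"
proof -
  define f where "f = (\<lambda>z. r * p z + lam \<bullet> g z)"
  obtain \<eta> where \<eta>: "prob_space \<eta>" "sets \<eta> = sets borel" "distr \<eta> borel fst = \<mu>"
      "measure \<eta> reinsurance_region = 1" and \<eta>s: "\<eta>s = sm_of_measure \<eta>"
    using optimal(1) by (auto simp: S_def treaties_def)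
  interpret \<eta>: prob_space \<eta> by fact
  have f_cont: "continuous_on state_space f"
    unfolding f_def by (intro continuous_intros p_cont g_cont)
  have D: "(state_space :: ((real ^ 'n) \<times> (real ^ 'n)) set) \<in> sets borel"
    and R: "(reinsurance_region :: ((real ^ 'n) \<times> (real ^ 'n)) set) \<in> sets borel"
    by (rule borel_closed[OF closed_state_space], rule borel_closed[OF closed_reinsurance_region])
  have f_meas: "set_borel_measurable borel state_space f"
    using borel_measurable_continuous_on_indicator[OF D f_cont]
    by (simp add: set_borel_measurable_def)
  obtain Q :: "(real ^ 'n) set" where Q: "countable Q" "Q \<subseteq> {0..1}" "{0..1} \<subseteq> closure Q"
    using separable[of "{0..1}"] by metis
  define U where "U q z = (fst z, quota_share q (fst z))"
    for q and z :: "(real ^ 'n) \<times> (real ^ 'n)"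
  define A where "A q = {z \<in> reinsurance_region. f (U q z) < f z}" for q
  have reg_sub: "(reinsurance_region :: ((real ^ 'n) \<times> (real ^ 'n)) set) \<subseteq> state_space"
    by (auto simp: reinsurance_region_def state_space_def)
  have U_cont: "continuous_on S (U q)" for S q
    unfolding U_def quota_share_def by (intro continuous_intros)
  have U_reg: "U q z \<in> reinsurance_region" if "q \<in> Q" "z \<in> reinsurance_region" for q z
    using that Q(2) quota_share_bounds[of q "fst z"]
    by (auto simp: U_def reinsurance_region_def)
  \<comment> \<open>\<open>f\<close> is controlled only on the state space, so the comparison with 0 is made after cutting off.\<close>
  have A_meas: "A q \<in> sets borel" if "q \<in> Q" for q
  proof -
    let ?h = "\<lambda>z. indicator reinsurance_region z *\<^sub>R (f (U q z) - f z)"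
    have "continuous_on reinsurance_region (\<lambda>z. f (U q z))"
      using f_cont by (rule continuous_on_compose2[OF _ U_cont]) (use U_reg that reg_sub in blast)
    then have "continuous_on reinsurance_region (\<lambda>z. f (U q z) - f z)"
      using f_cont reg_sub by (intro continuous_intros) (auto intro: continuous_on_subset)
    then have "?h \<in> borel_measurable borel"
      by (intro borel_measurable_continuous_on_indicator R)
    then have "{z \<in> space borel. ?h z < 0} \<in> sets borel"
      by measurable
    also have "{z \<in> space borel. ?h z < 0} = A q"
      by (auto simp: A_def indicator_def)
    finally show ?thesis .
  qed
  have opt_set: "{(x, y) \<in> reinsurance_region.
              is_arg_min (\<lambda>t. r * p (x, t) + lam \<bullet> g (x, t)) (\<lambda>t. t \<in> {0..x}) y}
     = reinsurance_region - (\<Union>q\<in>Q. A q)" (is "?E = _")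
  proof (intro set_eqI)
    fix z :: "(real ^ 'n) \<times> (real ^ 'n)"
    obtain x y where z: "z = (x, y)" by force
    show "z \<in> ?E \<longleftrightarrow> z \<in> reinsurance_region - (\<Union>q\<in>Q. A q)"
    proof (cases "z \<in> reinsurance_region")
      case True
      have "(\<exists>t\<in>{0..x}. f (x, t) < f (x, y)) \<longleftrightarrow> (\<exists>q\<in>Q. f (U q z) < f z)"
      proof
        assume "\<exists>t\<in>{0..x}. f (x, t) < f (x, y)"
        then obtain t where "0 \<le> t" "t \<le> x" "f (x, t) < f (x, y)" by auto
        then obtain q where "q \<in> Q" "f (x, quota_share q x) < f (x, y)"
          by (rule quota_share_improvement[OF f_cont Q(2,3)])
        then show "\<exists>q\<in>Q. f (U q z) < f z"
          by (auto simp: U_def z)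
      next
        assume "\<exists>q\<in>Q. f (U q z) < f z"
        then show "\<exists>t\<in>{0..x}. f (x, t) < f (x, y)"
          using U_reg[OF _ True] by (auto simp: U_def z reinsurance_region_def)
      qed
      with True show ?thesis
        by (auto simp: z is_arg_min_def f_def A_def reinsurance_region_def)
    qed (auto simp: z)
  qed
  \<comment> \<open>Boundedness of \<open>f\<close> is available on compact sets, hence the exhaustion by the boxes \<open>C k\<close>.\<close>
  have null: "measure \<eta> (A q) = 0" if q: "q \<in> Q" for q
  proof -
    define C where "C k = ({0..(\<chi> i. real k)} \<times> {0..(\<chi> i. real k)}
        :: ((real ^ 'n) \<times> (real ^ 'n)) set)" for k
    have C_compact: "compact (C k)" for k
      unfolding C_def by (intro compact_Times compact_interval)
    have C_sub: "C k \<subseteq> state_space" for k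
      by (auto simp: C_def state_space_def)
    have C_meas: "C k \<in> sets borel" for k
      using C_compact by (intro borel_closed compact_imp_closed)
    have zero: "measure \<eta> (A q \<inter> C k) = 0" for k
    proof (rule ccontr)
      assume "measure \<eta> (A q \<inter> C k) \<noteq> 0"
      then have pos: "measure \<eta> (A q \<inter> C k) > 0"
        by (simp add: zero_less_measure_iff)
      define T where "T z = (if z \<in> A q \<inter> C k then U q z else z)" for z
      have T_meas: "T \<in> borel_measurable borel"
        unfolding T_def using A_meas[OF q] C_meas[of k]
          borel_measurable_continuous_onI[OF U_cont[of UNIV q]]
        by (intro measurable_If_set) auto
      have T_fst: "fst (T z) = fst z" for z
        by (simp add: T_def U_def)
      have T_reg: "T z \<in> reinsurance_region" if "z \<in> reinsurance_region" for z
        using U_reg[OF q that] that by (simp add: T_def)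
      \<comment> \<open>Inside the reinsurance region a bound on the claim also bounds the ceded part.\<close>
      have T_C: "T ` (A q \<inter> C k) \<subseteq> C k"
      proof
        fix w assume "w \<in> T ` (A q \<inter> C k)"
        then obtain z where z: "z \<in> A q" "z \<in> C k" "w = U q z"
          by (auto simp: T_def)
        then have "w \<in> reinsurance_region" "fst w = fst z"
          using U_reg[OF q] by (auto simp: A_def U_def)
        with z(2) show "w \<in> C k"
          by (cases w) (auto simp: C_def reinsurance_region_def intro: order.trans)
      qed
      define \<eta>' where "\<eta>' = sm_of_measure (distr \<eta> borel T)"
      have \<eta>': "\<eta>' \<in> treaties \<mu>"
        unfolding \<eta>'_def using \<eta> T_meas T_fst T_reg by (rule treaty_pushforward)
      then have diff: "\<eta>' - \<eta>s \<in> (\<lambda>\<eta>. \<eta> - \<eta>s) ` treaties \<mu>" by blast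
      have "0 \<le> r * sm_integral (\<eta>' - \<eta>s) state_space p
          + lam \<bullet> sm_integral (\<eta>' - \<eta>s) state_space g"
        using multiplier[OF \<eta>'] by (simp add: dP_integral[OF diff] dG_integral[OF diff])
      also have "\<dots> = sm_integral (\<eta>' - \<eta>s) state_space f"
        unfolding f_def using p_integrable[OF diff] g_integrable[OF diff]
        by (rule sm_integral_linear_functional[symmetric])
      also have "\<dots> < 0"
        unfolding \<eta>'_def \<eta>s
      proof (rule sm_integral_reroute_neg[OF \<eta>.finite_measure_axioms \<eta>(2) T_meas _ pos _ _
            C_meas _ T_C D C_sub f_meas])
        show "A q \<inter> C k \<in> sets borel"
          using A_meas[OF q] C_meas by (rule sets.Int)
        show "bounded (f ` C k)"
          using f_cont C_sub C_compact
          by (intro compact_imp_bounded compact_continuous_image) (auto intro: continuous_on_subset)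
      qed (auto simp: T_def A_def)
      finally show False by simp
    qed
    have "A q \<subseteq> (\<Union>k. C k)"
    proof
      fix z assume "z \<in> A q"
      then have z: "0 \<le> snd z" "snd z \<le> fst z"
        by (auto simp: A_def reinsurance_region_def)
      obtain k where k: "norm (fst z) \<le> real k"
        using real_arch_simple by blast
      have "fst z \<le> (\<chi> i. real k)"
        using k order.trans[OF abs_ge_self component_le_norm_cart[of "fst z"]]
        by (auto simp: less_eq_vec_def intro: order.trans)
      with z have "z \<in> C k"
        by (cases z) (auto simp: C_def intro: order.trans)
      then show "z \<in> (\<Union>k. C k)" by blast
    qed
    then have "A q = (\<Union>k. A q \<inter> C k)" by blast
    moreover have "(\<Union>k. A q \<inter> C k) \<in> null_sets \<eta>"
      using zero A_meas[OF q] C_meas \<eta>(2)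
      by (intro null_sets_UN null_setsI) (auto simp: \<eta>.emeasure_eq_measure)
    ultimately show ?thesis
      by (metis \<eta>.emeasure_eq_measure null_setsD1 measure_eq_0_null_sets)
  qed
  have "(\<Union>q\<in>Q. A q) \<in> null_sets \<eta>"
    using null A_meas \<eta>(2) Q(1)
    by (intro null_sets_UN' null_setsI) (auto simp: \<eta>.emeasure_eq_measure)
  then have "measure \<eta> (reinsurance_region - (\<Union>q\<in>Q. A q)) = 1"
    using R \<eta>(2,4) by (simp add: measure_Diff_null_set)
  then show ?thesis
    unfolding opt_set \<eta>s using \<eta> \<eta>.finite_measure_axioms by (simp add: sm_value_sm_of_measure)
qed

end
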